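(* For every fixed integer $l\ge 2$, we have $M_l(2n,n)=(1+o(1))\,n^{3/2}$ as $n\to\infty$.
   Context: For positive integers $l,n,k$, $M_l(n,k)$ denotes the maximum number of edges in an $n$-vertex bipartite graph $G=(V,E)$ whose edge set is the union $E=E_1\cup\cdots\cup E_k$ of $k$ matchings which are $l$-separated, meaning: each $E_i$ is a matching, and there is no sequence of vertices $a_0,a_1,\ldots,a_t$ with $t\le l$ such that $a_0$ and $a_t$ are incident to two distinct edges from the same $E_i$ (one to each) and each of $a_0a_1, a_1a_2,\ldots,a_{t-1}a_t$ is an edge of $E$. *)

theory Defs
  imports Complex_Main "HOL-Library.Landau_Symbols"
begin

definition simple_graph :: "'a set \<Rightarrow> 'a set set \<Rightarrow> bool" where
  "simple_graph V E \<longleftrightarrow> finite V \<and> (\<forall>e\<in>E. e \<subseteq> V \<and> card e = 2)"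

definition bipartite_graph :: "'a set \<Rightarrow> 'a set set \<Rightarrow> bool" where
  "bipartite_graph V E \<longleftrightarrow> simple_graph V E \<and>
     (\<exists>X Y. X \<union> Y = V \<and> X \<inter> Y = {} \<and> (\<forall>e\<in>E. \<exists>x\<in>X. \<exists>y\<in>Y. e = {x, y}))"

definition is_matching :: "'a set set \<Rightarrow> bool" where
  "is_matching N \<longleftrightarrow> (\<forall>e\<in>N. \<forall>f\<in>N. e \<noteq> f \<longrightarrow> e \<inter> f = {})"

definition is_walk :: "'a set set \<Rightarrow> (nat \<Rightarrow> 'a) \<Rightarrow> nat \<Rightarrow> bool" where
  "is_walk E a t \<longleftrightarrow> (\<forall>j<t. {a j, a (Suc j)} \<in> E)"

definition separated_matchings :: "nat \<Rightarrow> 'a set set \<Rightarrow> nat \<Rightarrow> (nat \<Rightarrow> 'a set set) \<Rightarrow> bool" where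
  "separated_matchings l E k N \<longleftrightarrow>
     (\<forall>i<k. is_matching (N i) \<and>
        \<not> (\<exists>t a e f. t \<le> l \<and> is_walk E a t \<and> e \<in> N i \<and> f \<in> N i \<and> e \<noteq> f \<and>
              a 0 \<in> e \<and> a t \<in> f))"

text \<open>The possible edge numbers. Vertices are natural numbers, which loses no
  generality for finite graphs. The classes are not required to be pairwise disjoint,
  and may be empty.\<close>

definition separated_edge_counts :: "nat \<Rightarrow> nat \<Rightarrow> nat \<Rightarrow> nat set" where
  "separated_edge_counts l n k =
     {card E | (V :: nat set) E N. bipartite_graph V E \<and> card V = n \<and>
        E = (\<Union>i<k. N i) \<and> separated_matchings l E k N}"

definition max_separated :: "nat \<Rightarrow> nat \<Rightarrow> nat \<Rightarrow> nat" where
  "max_separated l n k = Max (separated_edge_counts l n k)"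

text \<open>The maximum is taken over a finite nonempty set.\<close>

lemma finite_separated_edge_counts: "finite (separated_edge_counts l n k)"
proof (rule finite_subset)
  show "separated_edge_counts l n k \<subseteq> {..2 ^ n}"
  proof
    fix c assume "c \<in> separated_edge_counts l n k"
    then obtain V :: "nat set" and E where c: "c = card E" "bipartite_graph V E" "card V = n"
      unfolding separated_edge_counts_def by blast
    then have "finite V" "E \<subseteq> Pow V"
      by (auto simp: bipartite_graph_def simple_graph_def)
    then have "card E \<le> card (Pow V)"
      by (intro card_mono) auto
    then show "c \<in> {..2 ^ n}"
      using c \<open>finite V\<close> by (simp add: card_Pow)
  qed
qed simp

lemma separated_edge_counts_nonempty: "separated_edge_counts l n k \<noteq> {}"
proof -
  have "bipartite_graph {..<n} {}"
    unfolding bipartite_graph_def simple_graph_def by blast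
  moreover have "separated_matchings l {} k (\<lambda>_. {} :: nat set set)"
    by (simp add: separated_matchings_def is_matching_def)
  ultimately have "card ({} :: nat set set) \<in> separated_edge_counts l n k"
    unfolding separated_edge_counts_def
    by (intro CollectI exI[of _ "{..<n}"] exI[of _ "{}"] exI[of _ "\<lambda>_. {}"]) auto
  then show ?thesis by blast
qed

end

theory Submission imports Defs "HOL-Analysis.Convex" "HOL-Real_Asymp.Real_Asymp" begin

text \<open>
  Upper bound: the vertices of a 2-separated matching have pairwise disjoint neighbourhoods, so
  their degrees add up to at most \<open>card V\<close>. Summing over the \<open>k\<close> matchings bounds
  the sum of all squared degrees by \<open>k * card V\<close>, and Cauchy--Schwarz turns this into
  \<open>2 * card E \<le> card V * sqrt k\<close>.

  Lower bound: with \<open>d = \<lfloor>sqrt n\<rfloor>\<close>, take \<open>d\<close> disjoint copies of the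
  complete bipartite graph on \<open>d + d\<close> vertices, and let the \<open>i\<close>-th matching consist of
  the \<open>i\<close>-th edge of each copy. Distinct edges of a matching lie in distinct components, so
  the matchings are separated at every distance.
\<close>

section \<open>Neighbourhoods and double counting\<close>

definition neighbourhood :: "'a set set \<Rightarrow> 'a \<Rightarrow> 'a set" where
  "neighbourhood E v = {u. {v, u} \<in> E}"

lemma finite_neighbourhood:
  assumes "simple_graph V E"
  shows "finite (neighbourhood E v)"
proof (rule finite_subset)
  show "neighbourhood E v \<subseteq> V" "finite V"
    using assms by (auto simp: neighbourhood_def simple_graph_def)
qed

lemma finite_edges:
  assumes "simple_graph V E"
  shows "finite E"
  by (rule finite_subset[of _ "Pow V"]) (use assms in \<open>auto simp: simple_graph_def\<close>)

lemma incident_edges_eq_image: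
  assumes "simple_graph V E"
  shows "{e \<in> E. v \<in> e} = (\<lambda>u. {v, u}) ` neighbourhood E v"
proof
  show "{e \<in> E. v \<in> e} \<subseteq> (\<lambda>u. {v, u}) ` neighbourhood E v"
  proof
    fix e assume e: "e \<in> {e \<in> E. v \<in> e}"
    then have "card e = 2"
      using assms by (auto simp: simple_graph_def)
    then obtain x y where "e = {x, y}"
      by (auto simp: card_2_iff)
    with e obtain u where "e = {v, u}"
      by auto
    with e show "e \<in> (\<lambda>u. {v, u}) ` neighbourhood E v"
      by (auto simp: neighbourhood_def)
  qed
qed (auto simp: neighbourhood_def)

lemma card_incident_edges:
  assumes "simple_graph V E"
  shows "card {e \<in> E. v \<in> e} = card (neighbourhood E v)"
proof -
  have "inj_on (\<lambda>u. {v, u}) (neighbourhood E v)"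
    by (auto simp: inj_on_def doubleton_eq_iff)
  then show ?thesis
    by (simp add: incident_edges_eq_image[OF assms] card_image)
qed

text \<open>Double counting of incidences, each weighted by \<open>g\<close> at its vertex. Weight 1
  gives the handshake identity; the degree as weight gives the sum of squared degrees.\<close>

lemma sum_edges_eq_sum_degrees:
  fixes g :: "'a \<Rightarrow> nat"
  assumes "simple_graph V E"
  shows "(\<Sum>e\<in>E. \<Sum>v\<in>e. g v) = (\<Sum>v\<in>V. card (neighbourhood E v) * g v)"
proof -
  have fV: "finite V" and fE: "finite E"
    using assms finite_edges[OF assms] by (auto simp: simple_graph_def)
  have "(\<Sum>e\<in>E. \<Sum>v\<in>e. g v) = (\<Sum>e\<in>E. \<Sum>v | v \<in> V \<and> v \<in> e. g v)"
    using assms by (intro sum.cong) (auto simp: simple_graph_def)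
  also have "\<dots> = (\<Sum>v\<in>V. \<Sum>e | e \<in> E \<and> v \<in> e. g v)"
    by (rule sum.swap_restrict) (use fV fE in auto)
  also have "\<dots> = (\<Sum>v\<in>V. card (neighbourhood E v) * g v)"
    by (simp add: card_incident_edges[OF assms])
  finally show ?thesis .
qed

section \<open>Upper bound\<close>

lemma sum_degrees_separated_matching_le:
  assumes G: "bipartite_graph V E" and sep: "separated_matchings l E k N"
    and l: "l \<ge> 2" and i: "i < k" and sub: "N i \<subseteq> E"
  shows "(\<Sum>e\<in>N i. \<Sum>v\<in>e. card (neighbourhood E v)) \<le> card V"
proof -
  have S: "simple_graph V E"
    using G by (simp add: bipartite_graph_def)
  have fV: "finite V" and fe: "\<And>e. e \<in> E \<Longrightarrow> finite e"
    using S finite_subset by (auto simp: simple_graph_def)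
  obtain X Y where XY: "X \<inter> Y = {}" and edge: "\<And>e. e \<in> E \<Longrightarrow> \<exists>x\<in>X. \<exists>y\<in>Y. e = {x, y}"
    using G by (auto simp: bipartite_graph_def)
  define B where "B e = (\<Union>v\<in>e. neighbourhood E v)" for e
  \<comment> \<open>A common neighbour would have to lie in both colour classes.\<close>
  have "neighbourhood E x \<inter> neighbourhood E y = {}" if "x \<in> X" "y \<in> Y" for x y
  proof (rule ccontr)
    assume "neighbourhood E x \<inter> neighbourhood E y \<noteq> {}"
    then obtain u where "{x, u} \<in> E" "{y, u} \<in> E"
      by (auto simp: neighbourhood_def)
    from edge[OF this(1)] edge[OF this(2)] that XY show False
      by (auto simp: doubleton_eq_iff)
  qed
  then have card_B: "card (B e) = (\<Sum>v\<in>e. card (neighbourhood E v))" if "e \<in> E" for e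
    unfolding B_def using that edge[OF that] fe[OF that] finite_neighbourhood[OF S]
    by (intro card_UN_disjoint) (auto simp: Int_commute)
  have disj: "B e \<inter> B f = {}" if "e \<in> N i" "f \<in> N i" "e \<noteq> f" for e f
  proof (rule ccontr)
    assume "B e \<inter> B f \<noteq> {}"
    then obtain u v w where uvw: "v \<in> e" "w \<in> f" "{v, u} \<in> E" "{w, u} \<in> E"
      by (auto simp: B_def neighbourhood_def)
    \<comment> \<open>The walk \<open>v\<close>, \<open>u\<close>, \<open>w\<close> has length 2,
      which \<open>l \<ge> 2\<close> forbids between distinct edges of a class.\<close>
    define a where "a j = (if j = 0 then v else if j = 1 then u else w)" for j :: nat
    have "is_walk E a 2"
      using uvw by (auto simp: is_walk_def a_def insert_commute less_2_cases_iff)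
    moreover have "a 0 \<in> e" "a 2 \<in> f"
      using uvw by (auto simp: a_def)
    ultimately show False
      using sep i l that unfolding separated_matchings_def by blast
  qed
  have "(\<Sum>e\<in>N i. \<Sum>v\<in>e. card (neighbourhood E v)) = (\<Sum>e\<in>N i. card (B e))"
    using sub card_B by (intro sum.cong) auto
  also have "\<dots> = card (\<Union>e\<in>N i. B e)"
  proof (rule card_UN_disjoint[symmetric])
    show "finite (N i)"
      using sub finite_edges[OF S] by (rule finite_subset)
    show "\<forall>e\<in>N i. finite (B e)"
      unfolding B_def using sub fe finite_neighbourhood[OF S] by blast
  qed (use disj in blast)
  also have "\<dots> \<le> card V"
    using S fV by (intro card_mono) (auto simp: B_def neighbourhood_def simple_graph_def)
  finally show ?thesis .
qed

text \<open>Classes may share edges, so a sum over their union is only bounded by the sum over the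
  classes.\<close>

lemma sum_UN_lessThan_le:
  fixes g :: "'a \<Rightarrow> nat" and k :: nat
  assumes "\<And>i. i < k \<Longrightarrow> finite (N i)"
  shows "sum g (\<Union>i<k. N i) \<le> (\<Sum>i<k. sum g (N i))"
  using assms
proof (induction k)
  case (Suc k)
  have "sum g (\<Union>i<Suc k. N i) = sum g ((\<Union>i<k. N i) \<union> N k)"
    by (simp add: lessThan_Suc Un_commute)
  also have "\<dots> \<le> sum g (\<Union>i<k. N i) + sum g (N k)"
    using Suc.prems by (subst sum.union_inter[symmetric]) auto
  also have "\<dots> \<le> (\<Sum>i<Suc k. sum g (N i))"
    using Suc by simp
  finally show ?case .
qed simp

lemma edges_le_of_separated_matchings:
  assumes G: "bipartite_graph V E" and E: "E = (\<Union>i<k. N i)"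
    and sep: "separated_matchings l E k N" and l: "l \<ge> 2"
  shows "2 * real (card E) \<le> real (card V) * sqrt (real k)"
proof -
  have S: "simple_graph V E"
    using G by (simp add: bipartite_graph_def)
  let ?d = "\<lambda>v. card (neighbourhood E v)"
  have sub: "N i \<subseteq> E" if "i < k" for i
    using E that by auto
  \<comment> \<open>Each edge contributes the degrees of its two ends, so a vertex contributes its
    degree once per incident edge.\<close>
  have "(\<Sum>v\<in>V. ?d v * ?d v) = (\<Sum>e\<in>E. \<Sum>v\<in>e. ?d v)"
    by (rule sum_edges_eq_sum_degrees[OF S, symmetric])
  also have "\<dots> \<le> (\<Sum>i<k. \<Sum>e\<in>N i. \<Sum>v\<in>e. ?d v)"
    using sum_UN_lessThan_le[of k N "\<lambda>e. \<Sum>v\<in>e. ?d v"] sub finite_edges[OF S] finite_subset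
    by (metis E)
  also have "\<dots> \<le> (\<Sum>i<k. card V)"
    using sum_degrees_separated_matching_le[OF G sep l] sub by (intro sum_mono) auto
  finally have squares: "(\<Sum>v\<in>V. ?d v * ?d v) \<le> k * card V"
    by simp
  have "2 * card E = (\<Sum>e\<in>E. \<Sum>v\<in>e. 1)"
    using S by (simp add: simple_graph_def)
  also have "\<dots> = (\<Sum>v\<in>V. ?d v)"
    using sum_edges_eq_sum_degrees[OF S, of "\<lambda>_. 1"] by simp
  finally have "(2 * real (card E))\<^sup>2 = (\<Sum>v\<in>V. real (?d v))\<^sup>2"
    by (metis of_nat_mult of_nat_numeral of_nat_sum)
  also have "\<dots> \<le> (\<Sum>v\<in>V. (real (?d v))\<^sup>2) * real (card V)"
    using Cauchy_Schwarz_ineq_sum[of "\<lambda>v. real (?d v)" "\<lambda>_. 1" V] by simp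
  also have "(\<Sum>v\<in>V. (real (?d v))\<^sup>2) = real (\<Sum>v\<in>V. ?d v * ?d v)"
    by (simp add: power2_eq_square)
  also have "\<dots> * real (card V) \<le> real (k * card V) * real (card V)"
    using squares by (intro mult_right_mono of_nat_mono) auto
  also have "\<dots> = (real (card V) * sqrt (real k))\<^sup>2"
    by (simp add: power_mult_distrib power2_eq_square)
  finally show ?thesis
    by (rule power2_le_imp_le) simp
qed

section \<open>Lower bound\<close>

lemma div_mod_decomposition_eq_iff:
  fixes d :: nat
  assumes "a < d" "a' < d"
  shows "c * d + a = c' * d + a' \<longleftrightarrow> c = c' \<and> a = a'"
  by (metis assms div_mult_self3 div_less less_zeroE add.right_neutral add_left_cancel)

text \<open>Each of the \<open>d\<close> copies has \<open>d * d\<close> edges. The hypothesis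
  leaves room for \<open>d * d\<close> classes and for \<open>d * d\<close> vertices on each
  side.\<close>

lemma cube_in_separated_edge_counts:
  assumes d: "d * d \<le> n"
  shows "d ^ 3 \<in> separated_edge_counts l (2 * n) n"
proof -
  \<comment> \<open>Vertex \<open>a\<close> on the left of copy \<open>c\<close> is \<open>c * d + a\<close>,
    and vertex \<open>b\<close> on its right is \<open>n + (c * d + b)\<close>.\<close>
  define edge where "edge i c = {c * d + i div d, n + (c * d + i mod d)}" for i c
  \<comment> \<open>An index \<open>i < d * d\<close> encodes the pair
    \<open>(i div d, i mod d)\<close> of left and right positions. The remaining classes are
    empty.\<close>
  define N where "N i = (if i < d * d then edge i ` {..<d} else {})" for i
  define E where "E = (\<Union>i<n. N i)"
  \<comment> \<open>The copy containing \<open>v\<close>; it is constant along walks.\<close>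
  define comp where "comp v = (if v < n then v div d else (v - n) div d)" for v
  have E_eq: "E = (\<lambda>(i, c). edge i c) ` ({..<d * d} \<times> {..<d})"
    using d by (fastforce simp: E_def N_def split: if_splits)
  have bound: "c * d + a < d * d" if "c < d" "a < d" for a c :: nat
  proof -
    have "c * d + a < Suc c * d"
      using that by simp
    also have "\<dots> \<le> d * d"
      using that by (intro mult_right_mono) auto
    finally show ?thesis .
  qed
  have digits: "i div d < d" "i mod d < d" if "i < d * d" for i
    using that by (cases "d = 0"; simp add: less_mult_imp_div_less)+
  have left: "c * d + i div d < n" and right: "c * d + i mod d < n"
    if "i < d * d" "c < d" for i c
    using bound[OF that(2) digits(1)[OF that(1)]] bound[OF that(2) digits(2)[OF that(1)]] d
    by linarith+
  have comp_edge: "comp v = c" if "v \<in> edge i c" "i < d * d" "c < d" for v i c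
    using that left[of i c] digits[of i] by (auto simp: edge_def comp_def)
  have inj: "inj_on (\<lambda>(i, c). edge i c) ({..<d * d} \<times> {..<d})"
  proof (rule inj_onI, clarsimp)
    fix i c i' c' assume *: "i < d * d" "c < d" "i' < d * d" "c' < d" "edge i c = edge i' c'"
    \<comment> \<open>The crossed matching of endpoints is impossible: left vertices are below
      \<open>n\<close>, right ones are not.\<close>
    then have "c * d + i div d = c' * d + i' div d" "c * d + i mod d = c' * d + i' mod d"
      using left[of i c] left[of i' c'] unfolding edge_def doubleton_eq_iff by linarith+
    with * digits have "c = c'" "i div d = i' div d" "i mod d = i' mod d"
      by (simp_all add: div_mod_decomposition_eq_iff)
    then show "i = i' \<and> c = c'"
      by (metis div_mult_mod_eq)
  qed
  have card_E: "card E = d ^ 3"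
    using card_image[OF inj] by (simp add: E_eq card_cartesian_product power3_eq_cube)
  have edge_sides: "\<exists>x\<in>{..<n}. \<exists>y\<in>{n..<2 * n}. e = {x, y}" if "e \<in> E" for e
  proof -
    from that obtain i c where "e = edge i c" "i < d * d" "c < d"
      unfolding E_eq by auto
    then show ?thesis
      using left[of i c] right[of i c] unfolding edge_def
      by (intro bexI[of _ "c * d + i div d"] bexI[of _ "n + (c * d + i mod d)"]) auto
  qed
  have bip: "bipartite_graph {..<2 * n} E"
    unfolding bipartite_graph_def simple_graph_def
  proof (intro conjI ballI)
    show "\<exists>X Y. X \<union> Y = {..<2 * n} \<and> X \<inter> Y = {} \<and> (\<forall>e\<in>E. \<exists>x\<in>X. \<exists>y\<in>Y. e = {x, y})"
      using edge_sides by (intro exI[of _ "{..<n}"] exI[of _ "{n..<2 * n}"]) auto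
  qed (use edge_sides in \<open>fastforce+\<close>)
  have comp_walk: "comp (a t) = comp (a 0)" if "is_walk E a t" for a t
    using that
  proof (induction t)
    case (Suc t)
    then have "{a t, a (Suc t)} \<in> E"
      by (simp add: is_walk_def)
    then obtain i c where "edge i c = {a t, a (Suc t)}" "i < d * d" "c < d"
      unfolding E_eq by auto
    then have "comp (a t) = c" "comp (a (Suc t)) = c"
      using comp_edge[of _ i c] by auto
    with Suc show ?case
      by (simp add: is_walk_def)
  qed simp
  have eq_if_comp: "e = f" if "e \<in> N i" "f \<in> N i" "v \<in> e" "w \<in> f" "comp v = comp w" for e f i v w
  proof -
    from that(1,2) obtain c c' where "i < d * d" "c < d" "c' < d" "e = edge i c" "f = edge i c'"
      by (auto simp: N_def split: if_splits)
    with that comp_edge show ?thesis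
      by metis
  qed
  \<comment> \<open>Taking \<open>v = w\<close> in \<open>eq_if_comp\<close> gives the matching
    property; taking the two ends of a walk gives separation.\<close>
  have "separated_matchings l E n N"
    unfolding separated_matchings_def is_matching_def
    using eq_if_comp comp_walk by (smt (verit, best) disjoint_iff)
  with bip show ?thesis
    unfolding separated_edge_counts_def
    by (intro CollectI exI[of _ "{..<2 * n}"] exI[of _ E] exI[of _ N]) (simp_all add: card_E, simp add: E_def)
qed

section \<open>Asymptotics\<close>

lemma max_separated_le:
  assumes "l \<ge> 2"
  shows "real (max_separated l (2 * n) n) \<le> real n * sqrt (real n)"
proof -
  have "max_separated l (2 * n) n \<in> separated_edge_counts l (2 * n) n"
    unfolding max_separated_def
    by (intro Max_in finite_separated_edge_counts separated_edge_counts_nonempty)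
  then obtain V :: "nat set" and E N where
    "max_separated l (2 * n) n = card E" "bipartite_graph V E" "card V = 2 * n"
    "E = (\<Union>i<n. N i)" "separated_matchings l E n N"
    unfolding separated_edge_counts_def by blast
  with edges_le_of_separated_matchings[of V E N n l] assms show ?thesis
    by simp
qed

lemma max_separated_ge:
  assumes "n \<ge> 1"
  shows "(sqrt (real n) - 1) ^ 3 \<le> real (max_separated l (2 * n) n)"
proof -
  \<comment> \<open>The largest \<open>d\<close> with \<open>d * d \<le> n\<close>; rounding costs
    less than 1 against \<open>sqrt n\<close>.\<close>
  define d where "d = nat \<lfloor>sqrt (real n)\<rfloor>"
  have d: "sqrt (real n) - 1 \<le> real d" "real d \<le> sqrt (real n)"
    unfolding d_def by (auto simp: of_nat_floor)
  have "real (d * d) \<le> real n"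
    using power_mono[OF d(2), of 2] by (simp add: power2_eq_square)
  then have "d ^ 3 \<le> max_separated l (2 * n) n"
    unfolding max_separated_def
    by (intro Max_ge finite_separated_edge_counts cube_in_separated_edge_counts)
      (use of_nat_le_iff in blast)
  \<comment> \<open>Here \<open>n \<ge> 1\<close> makes the base nonnegative, as
    \<open>power_mono\<close> requires.\<close>
  moreover have "(sqrt (real n) - 1) ^ 3 \<le> real d ^ 3"
    using d assms by (intro power_mono) auto
  ultimately show ?thesis
    by (metis of_nat_le_iff of_nat_power order_trans)
qed

theorem theorem2:
  fixes l :: nat
  assumes "l \<ge> 2"
  shows "(\<lambda>n::nat. real (max_separated l (2 * n) n)) \<sim>[at_top] (\<lambda>n. real n powr (3 / 2))"
proof (rule asymp_equiv_sandwich_real)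
  \<comment> \<open>Both bounds have leading term \<open>n powr (3 / 2)\<close>; expanding the cube
    leaves an error of order \<open>n\<close>.\<close>
  show "\<forall>\<^sub>F n in at_top. real (max_separated l (2 * n) n)
      \<in> {(sqrt (real n) - 1) ^ 3..real n * sqrt (real n)}"
    using eventually_ge_at_top[of 1]
    by eventually_elim (simp add: max_separated_ge max_separated_le assms)
  show "(\<lambda>n. (sqrt (real n) - 1) ^ 3) \<sim>[at_top] (\<lambda>n. real n powr (3 / 2))"
    by real_asymp
  show "(\<lambda>n. real n * sqrt (real n)) \<sim>[at_top] (\<lambda>n. real n powr (3 / 2))"
    by real_asymp
qed

end
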